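(* Let $G$ be a finite abelian group and let $a\in\operatorname{Aut}(G)$. Let $r(a)$ be the number of orbits of $a$ on $G$. Then, for every positive integer $m$, $$|\mathsf M_a(G,-m)|=(-1)^{r(a)-1}\,|\mathsf M_a^\circ(G,m)|.$$ Equivalently, $$L_{G,a}(-m)=(-1)^{r(a)-1}\,|m\mathcal P_{G,a}^\circ\cap\mathbb Z^{r(a)}|.$$
   Context: $G$ is written additively. A sequence over $G$ is a finite unordered sequence of elements of $G$ with repetitions allowed (a multiplicity vector $(b_g)\in\mathbb Z_{\ge0}^G$); its length is $\sum_g b_g$, its sum is $\sum_g b_g g$, its support is $\{g:b_g>0\}$; it is zero-sum if its sum is $0$. $\mathsf M(G,m)$ is the set of zero-sum sequences of length $m$. An automorphism $a$ acts on sequences termwise. $\mathsf M_a(G,m)=\{S\in\mathsf M(G,m):a\cdot S=S\}$ and $\mathsf M_a^\circ(G,m)=\{S\in\mathsf M_a(G,m):\operatorname{supp}(S)=G\}$. Let $\mathcal O(a)$ be the set of orbits of (the cyclic group generated by) $a$ on $G$, $r(a)=|\mathcal O(a)|$, and for $O\in\mathcal O(a)$ let $\ell(O)=|O|$, $\sigma(O)=\sum_{g\in O}g\in G$. Put $$\Delta_G^a=\Bigl\{(x_O)\in\mathbb R_{\ge0}^{\mathcal O(a)}:\sum_O\ell(O)x_O=1\Bigr\},\qquad \Lambda_G^a=\Bigl\{(c_O)\in\mathbb Z^{\mathcal O(a)}:\sum_O c_O\sigma(O)=0\Bigr\}.$$ $\Lambda_G^a$ is a full-rank sublattice of $\mathbb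 Z^{\mathcal O(a)}$; choose a linear isomorphism $T_a:\mathbb R^{\mathcal O(a)}\to\mathbb R^{r(a)}$ with $T_a(\Lambda_G^a)=\mathbb Z^{r(a)}$ and let $\mathcal P_{G,a}=T_a(\Delta_G^a)$, a rational simplex of dimension $r(a)-1$; $\mathcal P_{G,a}^\circ$ is its relative interior. For $m\ge0$ one has $|\mathsf M_a(G,m)|=|m\mathcal P_{G,a}\cap\mathbb Z^{r(a)}|$. $L_{G,a}$ denotes the Ehrhart quasipolynomial of $\mathcal P_{G,a}$, i.e. the unique quasipolynomial on $\mathbb Z$ with $L_{G,a}(m)=|m\mathcal P_{G,a}\cap\mathbb Z^{r(a)}|$ for all $m\ge0$, and $|\mathsf M_a(G,-m)|$ means $L_{G,a}(-m)$. *)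

theory Defs
  imports
    "HOL-Analysis.Analysis"
    "HOL-Combinatorics.Orbits"
    "HOL-Library.Multiset"
    "HOL-Computational_Algebra.Polynomial"
begin

text \<open>A finite abelian group is a type of class \<open>finite\<close> and \<open>ab_group_add\<close>; a sequence
  (a multiplicity vector) is a multiset.\<close>

definition zerosum_seqs :: "nat \<Rightarrow> 'g::{finite,ab_group_add} multiset set" where
  "zerosum_seqs m = {S. size S = m \<and> \<Sum>\<^sub># S = 0}"

definition fixed_zerosum_seqs ::
    "('g::{finite,ab_group_add} \<Rightarrow> 'g) \<Rightarrow> nat \<Rightarrow> 'g multiset set" where
  "fixed_zerosum_seqs a m = {S \<in> zerosum_seqs m. image_mset a S = S}"

definition full_fixed_zerosum_seqs ::
    "('g::{finite,ab_group_add} \<Rightarrow> 'g) \<Rightarrow> nat \<Rightarrow> 'g multiset set" where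
  "full_fixed_zerosum_seqs a m = {S \<in> fixed_zerosum_seqs a m. set_mset S = UNIV}"

text \<open>The library constant \<open>orbit a x\<close> collects the positive iterates of \<open>a\<close> at \<open>x\<close>. For a
  bijection of a finite type this is the orbit under the cyclic group generated by \<open>a\<close>.\<close>

definition orbits :: "('g \<Rightarrow> 'g) \<Rightarrow> 'g set set" where
  "orbits a = range (orbit a)"

definition orbit_count :: "('g \<Rightarrow> 'g) \<Rightarrow> nat" where
  "orbit_count a = card (orbits a)"

definition int_scale :: "int \<Rightarrow> 'g::ab_group_add \<Rightarrow> 'g" where
  "int_scale k g = (\<Sum>i<nat k. g) - (\<Sum>i<nat (- k). g)"

text \<open>The space of real vectors indexed by the orbits, realised as the coordinate subspace of
  \<open>real ^ 'g set\<close> of the vectors that vanish at every index which is not an orbit.\<close>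

definition orbit_space :: "('g::finite \<Rightarrow> 'g) \<Rightarrow> (real ^ 'g set) set" where
  "orbit_space a = {x. \<forall>A. A \<notin> orbits a \<longrightarrow> x $ A = 0}"

definition orbit_simplex :: "('g::finite \<Rightarrow> 'g) \<Rightarrow> (real ^ 'g set) set" where
  "orbit_simplex a = {x \<in> orbit_space a.
     (\<forall>A\<in>orbits a. 0 \<le> x $ A) \<and> (\<Sum>A\<in>orbits a. real (card A) * x $ A) = 1}"

definition orbit_lattice :: "('g::{finite,ab_group_add} \<Rightarrow> 'g) \<Rightarrow> (real ^ 'g set) set" where
  "orbit_lattice a =
     {(\<chi> A. if A \<in> orbits a then real_of_int (c A) else 0) | c :: 'g set \<Rightarrow> int.
        (\<Sum>A\<in>orbits a. int_scale (c A) (\<Sum>g\<in>A. g)) = 0}"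

definition int_points :: "(real ^ 'n) set" where
  "int_points = {x. \<forall>i. x $ i \<in> \<int>}"

text \<open>A linear isomorphism from the orbit space onto \<open>real ^ 'n\<close> which carries the lattice onto the
  integer points. It is given as a linear map on all of \<open>real ^ 'g set\<close>; only its values on the
  orbit space matter, and every linear map on that subspace has such an extension.\<close>

definition lattice_iso ::
    "('g::{finite,ab_group_add} \<Rightarrow> 'g) \<Rightarrow> (real ^ 'g set \<Rightarrow> real ^ 'n::finite) \<Rightarrow> bool" where
  "lattice_iso a T \<longleftrightarrow>
     linear T \<and> bij_betw T (orbit_space a) UNIV \<and> T ` orbit_lattice a = int_points"

definition orbit_polytope ::
    "('g::finite \<Rightarrow> 'g) \<Rightarrow> (real ^ 'g set \<Rightarrow> real ^ 'n::finite) \<Rightarrow> (real ^ 'n) set" where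
  "orbit_polytope a T = T ` orbit_simplex a"

text \<open>A quasipolynomial is a polynomial expression with periodic coefficients.\<close>

definition quasipolynomial :: "(int \<Rightarrow> real) \<Rightarrow> bool" where
  "quasipolynomial f \<longleftrightarrow>
     (\<exists>(p :: int \<Rightarrow> real poly) (N :: int). N > 0 \<and> (\<forall>k. p (k + N) = p k) \<and>
        (\<forall>k. f k = poly (p k) (real_of_int k)))"

definition dilate_count :: "(real ^ 'n::finite) set \<Rightarrow> nat \<Rightarrow> nat" where
  "dilate_count P m = card ((\<lambda>x. real m *\<^sub>R x) ` P \<inter> int_points)"

definition ehrhart :: "(real ^ 'n::finite) set \<Rightarrow> int \<Rightarrow> real" where
  "ehrhart P = (THE L. quasipolynomial L \<and> (\<forall>m. L (int m) = real (dilate_count P m)))"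

text \<open>The number of fixed zero-sum sequences of length \<open>k\<close>, extended to negative \<open>k\<close> by the Ehrhart
  quasipolynomial.\<close>

definition fixed_zerosum_count ::
    "('g::{finite,ab_group_add} \<Rightarrow> 'g) \<Rightarrow> (real ^ 'g set \<Rightarrow> real ^ 'n::finite) \<Rightarrow> int \<Rightarrow> real" where
  "fixed_zerosum_count a T k =
     (if 0 \<le> k then real (card (fixed_zerosum_seqs a (nat k)))
      else ehrhart (orbit_polytope a T) k)"

end

theory Submission imports Defs begin

text \<open>Fixed zero-sum sequences of length \<open>m\<close> are the nonnegative integer vectors \<open>c\<close> on the orbits
  that satisfy \<open>\<Sum>\<ell>(O) c\<^sub>O = m\<close> and a linear condition \<open>Z\<close> with values in the group; full support means
  \<open>c \<ge> 1\<close>. Let \<open>N = |G| \<sqdot> |G|!\<close> and \<open>n\<^sub>O = N / \<ell>(O)\<close>, so that \<open>Z\<close> depends on each \<open>c\<^sub>O\<close> only modulo \<open>n\<^sub>O\<close>.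
  Division with remainder, \<open>c = n q + d\<close> for \<open>c \<ge> 0\<close> and \<open>c = n (q + 1) - d\<close> for \<open>c \<ge> 1\<close>, involves the
  same finite set of residues \<open>d\<close> in both cases because \<open>Z\<close> is symmetric. It reduces the two counts
  to stars and bars for \<open>q\<close>, and the reciprocity law becomes the upper negation
  \<open>(K - 1 choose r - 1) = (-1)\<^bsup>r - 1\<^esup> (r - 1 - K choose r - 1)\<close> of binomial coefficients, summed over \<open>d\<close>.\<close>

section \<open>Stars and bars for integer vectors on a finite index set\<close>

definition vanishing_off :: "'i set \<Rightarrow> ('i \<Rightarrow> int) set" where
  "vanishing_off I = {c. \<forall>i. i \<notin> I \<longrightarrow> c i = 0}"

text \<open>Encoding a vector on \<open>I\<close> as a function that is zero off \<open>I\<close>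
  makes it the count function of exactly one multiset over \<open>I\<close>; the count of such
  multisets is then available for compositions.\<close>

lemma bij_betw_count_multisets_of_size:
  assumes "finite I"
  shows "bij_betw (\<lambda>M i. int (count M i)) (multisets_of_size I k)
           {q \<in> vanishing_off I. (\<forall>i\<in>I. 0 \<le> q i) \<and> (\<Sum>i\<in>I. q i) = int k}"
proof (rule bij_betw_byWitness[where f' = "\<lambda>q. Abs_multiset (\<lambda>i. nat (q i))"])
  show "\<forall>M\<in>multisets_of_size I k. Abs_multiset (\<lambda>i. nat (int (count M i))) = M"
    by (simp add: count_inverse)
  have cnt: "count (Abs_multiset (\<lambda>i. nat (q i))) = (\<lambda>i. nat (q i))" if "q \<in> vanishing_off I" for q
  proof (rule count_Abs_multiset)
    have "{x. 0 < nat (q x)} \<subseteq> I" using that by (force simp: vanishing_off_def)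
    then show "finite {x. 0 < nat (q x)}" using assms finite_subset by blast
  qed
  have nonneg: "0 \<le> q i" if "q \<in> vanishing_off I" "\<forall>i\<in>I. 0 \<le> q i" for q i
    using that by (cases "i \<in> I") (auto simp: vanishing_off_def)
  show "\<forall>q\<in>{q \<in> vanishing_off I. (\<forall>i\<in>I. 0 \<le> q i) \<and> (\<Sum>i\<in>I. q i) = int k}.
          (\<lambda>i. int (count (Abs_multiset (\<lambda>i. nat (q i))) i)) = q"
    by (auto simp: cnt nonneg)
  have size: "size M = (\<Sum>i\<in>I. count M i)" if "set_mset M \<subseteq> I" for M
    unfolding size_multiset_overloaded_eq using that assms
    by (intro sum.mono_neutral_left) (auto simp: not_in_iff)
  show "(\<lambda>M i. int (count M i)) ` multisets_of_size I k
          \<subseteq> {q \<in> vanishing_off I. (\<forall>i\<in>I. 0 \<le> q i) \<and> (\<Sum>i\<in>I. q i) = int k}"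
  proof safe
    fix M assume M: "M \<in> multisets_of_size I k"
    then have sub: "set_mset M \<subseteq> I" "size M = k" by (auto simp: multisets_of_size_def)
    show "(\<lambda>i. int (count M i)) \<in> vanishing_off I"
      using sub by (auto simp: vanishing_off_def not_in_iff)
    show "(\<Sum>i\<in>I. int (count M i)) = int k"
      using size[OF sub(1)] sub(2) by simp
  qed simp
  show "(\<lambda>q. Abs_multiset (\<lambda>i. nat (q i))) `
          {q \<in> vanishing_off I. (\<forall>i\<in>I. 0 \<le> q i) \<and> (\<Sum>i\<in>I. q i) = int k}
          \<subseteq> multisets_of_size I k"
  proof safe
    fix q assume q: "q \<in> vanishing_off I" "\<forall>i\<in>I. 0 \<le> q i" "(\<Sum>i\<in>I. q i) = int k"
    let ?M = "Abs_multiset (\<lambda>i. nat (q i))"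
    have sub: "set_mset ?M \<subseteq> I"
      using q(1) by (auto simp: set_mset_def cnt[OF q(1)] vanishing_off_def)
    have "int (size ?M) = int k"
      unfolding size[OF sub] cnt[OF q(1)] using q(2,3) by simp
    then show "?M \<in> multisets_of_size I k"
      using sub by (simp add: multisets_of_size_def)
  qed
qed

text \<open>The formula extends to \<open>- card I < k < 0\<close> because the binomial coefficient vanishes there. This
  makes the count below polynomial on each residue class of \<open>m \<ge> 0\<close>, not only for large \<open>m\<close>.\<close>
lemma card_compositions:
  fixes I :: "'i set"
  assumes "finite I" "I \<noteq> {}" and k: "- int (card I) < k"
  defines "Q \<equiv> {q \<in> vanishing_off I. (\<forall>i\<in>I. 0 \<le> q i) \<and> (\<Sum>i\<in>I. q i) = k}"
  shows "finite Q"
    and "real (card Q) = (of_int k + real (card I) - 1) gchoose (card I - 1)"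
proof -
  have r: "card I > 0" using assms by (simp add: card_gt_0_iff)
  have "finite Q \<and> real (card Q) = (of_int k + real (card I) - 1) gchoose (card I - 1)"
  proof (cases "0 \<le> k")
    case True
    then obtain j where j: "k = int j" using nonneg_int_cases by blast
    have bij: "bij_betw (\<lambda>M i. int (count M i)) (multisets_of_size I j) Q"
      using bij_betw_count_multisets_of_size[OF assms(1), of j] by (simp add: Q_def j)
    have "card Q = (card I + j - 1) choose j"
      using bij_betw_same_card[OF bij] card_multisets_of_size[OF assms(1)] by simp
    also have "\<dots> = (card I + j - 1) choose (card I - 1)"
      using r by (subst binomial_symmetric) auto
    finally have c: "card Q = (card I + j - 1) choose (card I - 1)" .
    \<comment> \<open>An infinite set has \<open>card\<close> equal to 0, so a positive cardinality
      already yields finiteness.\<close>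
    have "(card I + j - 1) choose (card I - 1) > 0"
      using r by (intro zero_less_binomial) auto
    with c have "finite Q" by (metis card.infinite less_irrefl)
    moreover have "real (card Q) = real (card I + j - 1) gchoose (card I - 1)"
      unfolding c by (rule binomial_gbinomial)
    ultimately show ?thesis using r j by (simp add: of_nat_diff algebra_simps)
  next
    case False
    have "Q = {}"
      using False by (auto simp: Q_def sum_nonneg)
    define j where "j = nat (k + int (card I) - 1)"
    have "of_int k + real (card I) - 1 = real j"
      using k by (simp add: j_def)
    moreover have "j < card I - 1" using False k r unfolding j_def by linarith
    then have "real j gchoose (card I - 1) = 0"
      by (simp flip: binomial_gbinomial add: binomial_eq_0)
    ultimately show ?thesis using \<open>Q = {}\<close> by simp
  qed
  then show "finite Q" "real (card Q) = (of_int k + real (card I) - 1) gchoose (card I - 1)"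
    by auto
qed

subsection \<open>Quasipolynomials\<close>

lemma gbinomial_eq_poly:
  "\<exists>p :: real poly. \<forall>x. poly p x = (x gchoose j)"
proof
  show "\<forall>x. poly (smult (1 / fact j) (\<Prod>i=0..<j. [:- real i, 1:])) x = (x gchoose j)"
    by (simp add: gbinomial_prod_rev poly_prod)
qed

text \<open>On an arithmetic progression through \<open>k\<close> both functions are given by fixed
  polynomials. These agree at infinitely many nonnegative arguments, hence are equal, and the
  equality carries over to \<open>k\<close> even when \<open>k\<close> is negative.\<close>

lemma quasipolynomial_eqI:
  assumes "quasipolynomial f" "quasipolynomial g" "\<And>m. f (int m) = g (int m)"
  shows "f = g"
proof
  fix k :: int
  obtain p M where p: "M > 0" "\<And>k. p (k + M) = p k" "\<And>k. f k = poly (p k) (of_int k)"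
    using assms(1) unfolding quasipolynomial_def by blast
  obtain q N where q: "N > 0" "\<And>k. q (k + N) = q k" "\<And>k. g k = poly (q k) (of_int k)"
    using assms(2) unfolding quasipolynomial_def by blast
  have pp: "p (k + int j * M) = p k" for j k
  proof (induction j)
    case (Suc j)
    have "k + int (Suc j) * M = (k + int j * M) + M" by (simp add: algebra_simps)
    then show ?case using Suc p(2)[of "k + int j * M"] by (simp only:)
  qed simp
  have qq: "q (k + int j * N) = q k" for j k
  proof (induction j)
    case (Suc j)
    have "k + int (Suc j) * N = (k + int j * N) + N" by (simp add: algebra_simps)
    then show ?case using Suc q(2)[of "k + int j * N"] by (simp only:)
  qed simp
  \<comment> \<open>\<open>M * N\<close> is a common period, so both coefficient polynomials stay
    constant along \<open>h\<close>.\<close>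
  define h where "h j = k + int j * (M * N)" for j
  have hp: "p (h j) = p k" "q (h j) = q k" for j
    using pp[of k "j * nat N"] qq[of k "j * nat M"] p(1) q(1) by (simp_all add: h_def mult_ac)
  have MN: "M * N > 0" using p(1) q(1) by simp
  \<comment> \<open>From index \<open>nat (- k)\<close> on, \<open>h j\<close> is nonnegative, which
    is where \<open>f\<close> and \<open>g\<close> are known to agree.\<close>
  have root: "poly (p k - q k) (of_int (h j)) = 0" if "j \<ge> nat (- k)" for j
  proof -
    have "int j * 1 \<le> int j * (M * N)" using MN by (intro mult_left_mono) auto
    then have "h j \<ge> 0" using that by (simp add: h_def)
    then have "f (h j) = g (h j)" using assms(3)[of "nat (h j)"] by simp
    then show ?thesis using p(3)[of "h j"] q(3)[of "h j"] by (simp add: hp)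
  qed
  have "inj (\<lambda>j. real_of_int (h j))"
    using MN by (auto simp: inj_on_def h_def)
  then have "infinite ((\<lambda>j. real_of_int (h j)) ` {nat (- k)..})"
    by (metis finite_imageD infinite_Ici inj_on_subset subset_UNIV)
  moreover have "(\<lambda>j. real_of_int (h j)) ` {nat (- k)..} \<subseteq> {x. poly (p k - q k) x = 0}"
    using root by auto
  ultimately have "p k - q k = 0"
    using poly_roots_finite finite_subset by blast
  then show "f k = g k" by (simp add: p(3) q(3))
qed

lemma ehrhart_eqI:
  assumes "quasipolynomial L" "\<And>m. L (int m) = real (dilate_count P m)"
  shows "ehrhart P = L"
  unfolding ehrhart_def
  by (rule the_equality) (use assms in \<open>auto intro: quasipolynomial_eqI\<close>)

subsection \<open>Reciprocity for weighted compositions with a periodic condition\<close>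

text \<open>Abstract form of the orbit problem: \<open>w i\<close> stands for an orbit length and
  \<open>Z\<close> for the zero-sum condition. The step \<open>N div w i\<close> permitted by
  \<open>periodic\<close> raises the weight by the same \<open>N\<close> at every index.\<close>

locale weighted_system =
  fixes I :: "'i set" and w :: "'i \<Rightarrow> int" and Z :: "('i \<Rightarrow> int) \<Rightarrow> bool" and N :: int
  assumes finite_index: "finite I" and index_nonempty: "I \<noteq> {}"
    and weight_pos: "\<And>i. i \<in> I \<Longrightarrow> w i > 0"
    and modulus_pos: "N > 0" and weight_dvd: "\<And>i. i \<in> I \<Longrightarrow> w i dvd N"
    and periodic: "\<And>c q. Z (\<lambda>i. c i + N div w i * q i) = Z c"
    and symmetric: "\<And>c. Z (\<lambda>i. - c i) = Z c"
begin

definition period :: "'i \<Rightarrow> int" where "period i = N div w i"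

definition weight :: "('i \<Rightarrow> int) \<Rightarrow> int" where "weight c = (\<Sum>i\<in>I. w i * c i)"

text \<open>The first argument is the lower bound of the entries: 0 for sequences, 1 for full support.\<close>
definition solutions :: "int \<Rightarrow> int \<Rightarrow> ('i \<Rightarrow> int) set" where
  "solutions s m = {c \<in> vanishing_off I. (\<forall>i\<in>I. s \<le> c i) \<and> weight c = m \<and> Z c}"

definition residues :: "('i \<Rightarrow> int) set" where
  "residues = {d \<in> vanishing_off I. (\<forall>i\<in>I. 0 \<le> d i \<and> d i < period i) \<and> Z d}"

definition quotients :: "int \<Rightarrow> ('i \<Rightarrow> int) set" where
  "quotients k = {q \<in> vanishing_off I. (\<forall>i\<in>I. 0 \<le> q i) \<and> N * (\<Sum>i\<in>I. q i) = k}"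

text \<open>The stars-and-bars value continued to all integers; for very negative \<open>k\<close>
  it is no longer a cardinality, and reciprocity is about these values.\<close>

definition quotient_count :: "int \<Rightarrow> real" where
  "quotient_count k = (if N dvd k
     then (of_int (k div N) + real (card I) - 1) gchoose (card I - 1) else 0)"

text \<open>The candidate for the Ehrhart quasipolynomial, meaningful at negative \<open>m\<close>
  too.\<close>

definition hilbert :: "int \<Rightarrow> real" where
  "hilbert m = (\<Sum>d\<in>residues. quotient_count (m - weight d))"

lemma weight_period: "i \<in> I \<Longrightarrow> w i * period i = N"
  by (simp add: period_def weight_dvd)

lemma period_pos: "i \<in> I \<Longrightarrow> period i > 0"
  using weight_period weight_pos modulus_pos by (metis zero_less_mult_pos)

lemma weight_affine: "weight (\<lambda>i. d i + period i * q i) = weight d + N * (\<Sum>i\<in>I. q i)"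
proof -
  have "weight (\<lambda>i. d i + period i * q i) = (\<Sum>i\<in>I. w i * d i + N * q i)"
    unfolding weight_def
  proof (rule sum.cong)
    fix i assume "i \<in> I"
    then show "w i * (d i + period i * q i) = w i * d i + N * q i"
      using weight_period[of i] by (simp add: distrib_left flip: mult.assoc)
  qed simp
  then show ?thesis by (simp add: weight_def sum.distrib sum_distrib_left)
qed

lemma Z_shift: "Z (\<lambda>i. c i + period i * q i) = Z c"
  using periodic by (simp add: period_def)

text \<open>Each term \<open>w i * d i\<close> lies below \<open>w i * period i = N\<close>. The
  upper bound keeps \<open>m - weight d\<close> in the range of \<open>card_quotients\<close> for
  all \<open>m \<ge> 0\<close>, the lower bound does the same for full support.\<close>

lemma weight_residue:
  assumes "d \<in> residues"
  shows "0 \<le> weight d" "weight d < N * int (card I)"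
proof -
  show "0 \<le> weight d" unfolding weight_def
    using assms weight_pos by (intro sum_nonneg) (force simp: residues_def)
  have "weight d < (\<Sum>i\<in>I. N)"
    unfolding weight_def
  proof (rule sum_strict_mono[OF finite_index index_nonempty])
    fix i assume "i \<in> I"
    then have "w i * d i < w i * period i"
      using assms weight_pos[of i] by (simp add: residues_def)
    then show "w i * d i < N" using weight_period[OF \<open>i \<in> I\<close>] by simp
  qed
  then show "weight d < N * int (card I)" by (simp add: mult.commute)
qed

lemma finite_residues: "finite residues"
proof (rule finite_subset)
  let ?B = "Max (period ` I)"
  show "residues \<subseteq> {f. (\<forall>i\<in>I. f i \<in> {0..?B}) \<and> (\<forall>i. i \<notin> I \<longrightarrow> f i = 0)}"
    using finite_index by (force simp: residues_def vanishing_off_def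
       intro: order.trans[OF less_imp_le Max_ge])
  show "finite {f. (\<forall>i\<in>I. f i \<in> {0..?B}) \<and> (\<forall>i. i \<notin> I \<longrightarrow> f i = 0)}"
    using finite_set_of_finite_funs[OF finite_index, of "{0..?B}" 0]
    by (rule rev_finite_subset) auto
qed

lemma card_quotients:
  assumes "k > - (N * int (card I))"
  shows "finite (quotients k)" "real (card (quotients k)) = quotient_count k"
proof -
  have "finite (quotients k) \<and> real (card (quotients k)) = quotient_count k"
  proof (cases "N dvd k")
    case True
    then obtain j where j: "k = N * j" by blast
    have "N * (- int (card I)) < N * j" using assms by (simp add: j)
    then have "- int (card I) < j" using modulus_pos by (simp only: mult_less_cancel_left_pos[OF modulus_pos])
    moreover have "quotients k = {q \<in> vanishing_off I. (\<forall>i\<in>I. 0 \<le> q i) \<and> (\<Sum>i\<in>I. q i) = j}"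
      using modulus_pos by (simp add: quotients_def j)
    ultimately show ?thesis
      using card_compositions[OF finite_index index_nonempty] modulus_pos
      by (simp add: quotient_count_def j)
  next
    case False
    then have "quotients k = {}" by (auto simp: quotients_def)
    then show ?thesis using False by (simp add: quotient_count_def)
  qed
  then show "finite (quotients k)" "real (card (quotients k)) = quotient_count k" by auto
qed

lemma quotient_count_mult:
  "quotient_count (N * j) = (of_int j + real (card I) - 1) gchoose (card I - 1)"
  using modulus_pos by (simp add: quotient_count_def)

text \<open>For \<open>k = N * j\<close> and \<open>r = card I\<close> the upper arguments are
  \<open>j - 1\<close> and \<open>r - 1 - j\<close>, which upper negation exchanges. The shift by
  \<open>N * r\<close> comes from raising every quotient by 1.\<close>

lemma quotient_count_reciprocity:
  "quotient_count (k - N * int (card I)) = (-1) ^ (card I - 1) * quotient_count (- k)"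
proof (cases "N dvd k")
  case True
  then obtain j where j: "k = N * j" by blast
  have r: "card I > 0" using finite_index index_nonempty by (simp add: card_gt_0_iff)
  have "k - N * int (card I) = N * (j - int (card I))" "- k = N * (- j)"
    by (simp_all add: j algebra_simps)
  then have "quotient_count (k - N * int (card I)) = (of_int j - 1) gchoose (card I - 1)"
    "quotient_count (- k) = (real (card I) - 1 - of_int j) gchoose (card I - 1)"
    by (simp_all only: quotient_count_mult) (simp_all add: algebra_simps)
  then show ?thesis
    using r gbinomial_negated_upper[of "of_int j - 1 :: real" "card I - 1"]
    by (simp add: of_nat_diff algebra_simps)
next
  case False
  then have "\<not> N dvd k - N * int (card I)" by (simp add: dvd_diff_left_iff)
  then show ?thesis using False by (simp add: quotient_count_def)
qed

section \<open>Division with remainder as a bijection, for lower bounds 0 and 1\<close>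

lemma bij_betw_solutions_0:
  "bij_betw (\<lambda>(d, q) i. d i + period i * q i)
     (SIGMA d:residues. quotients (m - weight d)) (solutions 0 m)"
proof (rule bij_betw_byWitness[where f' = "\<lambda>c. (\<lambda>i. c i mod period i, \<lambda>i. c i div period i)"])
  show "\<forall>x\<in>SIGMA d:residues. quotients (m - weight d).
      (\<lambda>c. (\<lambda>i. c i mod period i, \<lambda>i. c i div period i)) ((\<lambda>(d, q) i. d i + period i * q i) x) = x"
  proof (safe; rule ext)
    fix d q i assume dq: "d \<in> residues" "q \<in> quotients (m - weight d)"
    have "(d i + period i * q i) mod period i = d i \<and> (d i + period i * q i) div period i = q i"
    proof (cases "i \<in> I")
      case True
      then show ?thesis using dq period_pos[of i] by (simp add: residues_def)
    next
      \<comment> \<open>Off \<open>I\<close> both \<open>d i\<close> and \<open>q i\<close> are 0,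
        and \<open>0 mod p\<close> and \<open>0 div p\<close> are 0 for every \<open>p\<close>,
        including 0.\<close>
      case False
      then show ?thesis using dq by (simp add: residues_def quotients_def vanishing_off_def)
    qed
    then show "(d i + period i * q i) mod period i = d i" "(d i + period i * q i) div period i = q i" by auto
  qed
  show "\<forall>c\<in>solutions 0 m. (\<lambda>(d, q) i. d i + period i * q i) (\<lambda>i. c i mod period i, \<lambda>i. c i div period i) = c"
    by simp
  show "(\<lambda>(d, q) i. d i + period i * q i) ` (SIGMA d:residues. quotients (m - weight d)) \<subseteq> solutions 0 m"
  proof safe
    fix d q assume dq: "d \<in> residues" "q \<in> quotients (m - weight d)"
    have "0 \<le> d i + period i * q i" if "i \<in> I" for i
      using dq that period_pos[OF that] by (simp add: residues_def quotients_def)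
    then show "(\<lambda>i. d i + period i * q i) \<in> solutions 0 m"
      using dq by (simp add: solutions_def weight_affine Z_shift residues_def quotients_def
          vanishing_off_def)
  qed
  show "(\<lambda>c. (\<lambda>i. c i mod period i, \<lambda>i. c i div period i)) ` solutions 0 m
     \<subseteq> (SIGMA d:residues. quotients (m - weight d))"
  proof safe
    fix c assume c: "c \<in> solutions 0 m"
    have split: "(\<lambda>i. c i mod period i + period i * (c i div period i)) = c" by simp
    show "(\<lambda>i. c i mod period i) \<in> residues"
      using c period_pos Z_shift[of "\<lambda>i. c i mod period i" "\<lambda>i. c i div period i"]
      by (auto simp: solutions_def residues_def vanishing_off_def split)
    show "(\<lambda>i. c i div period i) \<in> quotients (m - weight (\<lambda>i. c i mod period i))"
      using c period_pos weight_affine[of "\<lambda>i. c i mod period i" "\<lambda>i. c i div period i"]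
      by (auto simp: solutions_def quotients_def vanishing_off_def split pos_imp_zdiv_nonneg_iff)
  qed
qed

text \<open>Here \<open>- c\<close> is divided instead of \<open>c\<close>: with
  \<open>0 \<le> d < p\<close>, the number \<open>p * (q + 1) - d\<close> is at least 1 exactly when
  \<open>q \<ge> 0\<close>. The \<open>if\<close> is there because the formula would give
  \<open>period i\<close> instead of 0 off \<open>I\<close>.\<close>

lemma bij_betw_solutions_1:
  "bij_betw (\<lambda>(d, q) i. if i \<in> I then period i * (q i + 1) - d i else 0)
     (SIGMA d:residues. quotients (m + weight d - N * int (card I))) (solutions 1 m)"
  (is "bij_betw ?f ?A ?B")
proof (rule bij_betw_byWitness[where
      f' = "\<lambda>c. (\<lambda>i. (- c i) mod period i, \<lambda>i. if i \<in> I then - ((- c i) div period i) - 1 else 0)"])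
  let ?g = "\<lambda>c. (\<lambda>i. (- c i) mod period i, \<lambda>i. if i \<in> I then - ((- c i) div period i) - 1 else 0)"
  \<comment> \<open>As the negative of a shifted residue vector, \<open>?f (d, q)\<close> becomes
    accessible to \<open>weight_affine\<close>, \<open>Z_shift\<close> and
    \<open>symmetric\<close>.\<close>
  have f_eq: "?f (d, q) = (\<lambda>i. - (d i + period i * (if i \<in> I then - (q i + 1) else 0)))"
    if "d \<in> vanishing_off I" for d q
    using that by (auto simp: vanishing_off_def algebra_simps)
  have weight_f: "weight (?f (d, q)) = N * (\<Sum>i\<in>I. q i) + N * int (card I) - weight d"
    if "d \<in> vanishing_off I" for d q
  proof -
    have "weight (?f (d, q)) = - weight (\<lambda>i. d i + period i * (if i \<in> I then - (q i + 1) else 0))"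
      unfolding f_eq[OF that] weight_def by (simp only: mult_minus_right sum_negf)
    also have "\<dots> = - weight d - N * (\<Sum>i\<in>I. - (q i + 1))"
      unfolding weight_affine by (simp cong: sum.cong)
    also have "(\<Sum>i\<in>I. - (q i + 1)) = - (\<Sum>i\<in>I. q i) - int (card I)"
      by (simp add: sum_negf sum.distrib sum_subtractf)
    finally show ?thesis by (simp add: algebra_simps)
  qed
  have Z_f: "Z (?f (d, q)) = Z d" if "d \<in> vanishing_off I" for d q
    unfolding f_eq[OF that] symmetric Z_shift ..
  show "\<forall>x\<in>?A. ?g (?f x) = x"
  proof (safe; rule ext)
    fix d q i assume dq: "d \<in> residues" "q \<in> quotients (m + weight d - N * int (card I))"
    have "(- (if i \<in> I then period i * (q i + 1) - d i else 0)) mod period i = d i \<and>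
      (if i \<in> I then - ((- (if i \<in> I then period i * (q i + 1) - d i else 0)) div period i) - 1 else 0) = q i"
    proof (cases "i \<in> I")
      case True
      have eq: "- (period i * (q i + 1) - d i) = d i + period i * (- (q i + 1))" by (simp add: algebra_simps)
      have divmod: "(d i + period i * (- (q i + 1))) mod period i = d i"
        "(d i + period i * (- (q i + 1))) div period i = - (q i + 1)"
        using dq period_pos[of i] True by (simp_all only: mod_mult_self2 div_mult_self2) (simp_all add: residues_def)
      show ?thesis by (simp only: True if_True eq divmod) simp
    next
      case False
      then show ?thesis using dq by (simp add: residues_def quotients_def vanishing_off_def)
    qed
    then show "(- (if i \<in> I then period i * (q i + 1) - d i else 0)) mod period i = d i"
      "(if i \<in> I then - ((- (if i \<in> I then period i * (q i + 1) - d i else 0)) div period i) - 1 else 0) = q i"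
      by auto
  qed
  have fg: "?f (?g c) = c" if "c \<in> vanishing_off I" for c
  proof
    fix i
    have "- (period i * ((- c i) div period i)) - (- c i) mod period i = c i"
      using mult_div_mod_eq[of "period i" "- c i"] by linarith
    then show "?f (?g c) i = c i" using that by (simp add: vanishing_off_def)
  qed
  then show "\<forall>c\<in>?B. ?f (?g c) = c" by (simp add: solutions_def)
  show "?f ` ?A \<subseteq> ?B"
  proof safe
    fix d q assume dq: "d \<in> residues" "q \<in> quotients (m + weight d - N * int (card I))"
    then have van: "d \<in> vanishing_off I" by (simp add: residues_def)
    have "1 \<le> period i * (q i + 1) - d i" if "i \<in> I" for i
    proof -
      have "period i * 1 \<le> period i * (q i + 1)"
        using dq that period_pos[of i] by (intro mult_left_mono) (auto simp: quotients_def)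
      moreover have "d i < period i" using dq that by (simp add: residues_def)
      ultimately show ?thesis by linarith
    qed
    then show "(\<lambda>i. if i \<in> I then period i * (q i + 1) - d i else 0) \<in> solutions 1 m"
      using dq weight_f[OF van, of q] Z_f[OF van, of q]
      by (auto simp: solutions_def residues_def quotients_def vanishing_off_def)
  qed
  show "?g ` ?B \<subseteq> ?A"
  proof (rule image_subsetI)
    fix c assume c: "c \<in> ?B"
    then have van: "c \<in> vanishing_off I" by (simp add: solutions_def)
    have van': "fst (?g c) \<in> vanishing_off I" using van by (simp add: vanishing_off_def)
    have Zd: "Z (fst (?g c))" "weight c = N * (\<Sum>i\<in>I. snd (?g c) i) + N * int (card I) - weight (fst (?g c))"
      using Z_f[OF van', of "snd (?g c)"] weight_f[OF van', of "snd (?g c)"] fg[OF van] c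
      by (simp_all add: solutions_def)
    \<comment> \<open>Since \<open>c i \<ge> 1\<close>, the dividend is negative and the floor
      quotient is at most -1.\<close>
    have "0 \<le> - ((- c i) div period i) - 1" if "i \<in> I" for i
    proof -
      have "(- c i) div period i < 0"
        using c that period_pos[OF that] by (intro div_neg_pos_less0) (auto simp: solutions_def)
      then show ?thesis by simp
    qed
    then show "?g c \<in> ?A"
      using Zd c van' period_pos
      by (auto simp: solutions_def residues_def quotients_def vanishing_off_def)
  qed
qed

section \<open>Counting solutions by the quasipolynomial and its reciprocity\<close>

lemma card_solutions_0:
  assumes "0 \<le> m"
  shows "real (card (solutions 0 m)) = hilbert m"
proof -
  have gt: "m - weight d > - (N * int (card I))" if "d \<in> residues" for d
    using weight_residue[OF that] assms by simp
  have "card (solutions 0 m) = (\<Sum>d\<in>residues. card (quotients (m - weight d)))"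
    unfolding bij_betw_same_card[OF bij_betw_solutions_0, symmetric]
    using finite_residues card_quotients(1) gt by (intro card_SigmaI) auto
  then show ?thesis
    using card_quotients(2) gt by (simp add: hilbert_def)
qed

text \<open>Reciprocity is applied to each residue with \<open>k = m + weight d\<close>, so that
  \<open>- k = - m - weight d\<close> is the argument occurring in \<open>hilbert (- m)\<close>.
  Positivity of \<open>m\<close> gives the strict bound of \<open>card_quotients\<close> even for
  \<open>d = 0\<close>.\<close>

lemma card_solutions_1:
  assumes "0 < m"
  shows "real (card (solutions 1 m)) = (-1) ^ (card I - 1) * hilbert (- m)"
proof -
  have gt: "m + weight d - N * int (card I) > - (N * int (card I))" if "d \<in> residues" for d
    using weight_residue[OF that] assms by simp
  have "card (solutions 1 m) = (\<Sum>d\<in>residues. card (quotients (m + weight d - N * int (card I))))"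
    unfolding bij_betw_same_card[OF bij_betw_solutions_1, symmetric]
    using finite_residues card_quotients(1) gt by (intro card_SigmaI) auto
  then have "real (card (solutions 1 m))
      = (\<Sum>d\<in>residues. quotient_count (m + weight d - N * int (card I)))"
    using card_quotients(2) gt by simp
  then show ?thesis
    by (simp add: hilbert_def quotient_count_reciprocity sum_distrib_left)
qed

lemma quasipolynomial_hilbert: "quasipolynomial hilbert"
proof -
  obtain p :: "real poly" where p: "\<And>x. poly p x = (x gchoose (card I - 1))"
    using gbinomial_eq_poly by blast
  \<comment> \<open>The inner linear polynomial sends \<open>k\<close> to
    \<open>(k - weight d) / N + card I - 1\<close>; the divisibility test depends on
    \<open>k\<close> only modulo \<open>N\<close>, which gives the period.\<close>
  define P where "P k = (\<Sum>d\<in>residues. if N dvd k - weight d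
     then pcompose p [:real (card I) - 1 - of_int (weight d) / of_int N, 1 / of_int N:] else 0)" for k
  have "P (k + N) = P k" for k
  proof -
    have "N dvd k + N - weight d \<longleftrightarrow> N dvd k - weight d" for d
      by (metis add_diff_eq add.commute dvd_add_triv_left_iff)
    then show ?thesis by (simp add: P_def)
  qed
  moreover have "hilbert k = poly (P k) (of_int k)" for k
    unfolding hilbert_def P_def poly_sum
  proof (rule sum.cong)
    fix d
    show "quotient_count (k - weight d) = poly (if N dvd k - weight d
      then pcompose p [:real (card I) - 1 - of_int (weight d) / of_int N, 1 / of_int N:] else 0) (of_int k)"
    proof (cases "N dvd k - weight d")
      case True
      then have div: "real_of_int ((k - weight d) div N) = (of_int k - of_int (weight d)) / of_int N"
        by (simp add: real_of_int_div)
      show ?thesis using True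
        by (simp add: quotient_count_def poly_pcompose p div)
           (simp add: diff_divide_distrib algebra_simps)
    qed (simp add: quotient_count_def)
  qed simp
  ultimately show ?thesis
    unfolding quasipolynomial_def using modulus_pos by blast
qed

end

subsection \<open>Integer multiples in a finite abelian group\<close>

lemma int_scale_0 [simp]: "int_scale 0 g = 0"
  by (simp add: int_scale_def)

lemma int_scale_add_1: "int_scale (k + 1) g = int_scale k g + g"
proof (cases "0 \<le> k")
  case True
  then have "nat (k + 1) = Suc (nat k)" "nat (- (k + 1)) = 0" "nat (- k) = 0" by auto
  then show ?thesis by (simp add: int_scale_def add.commute)
next
  case False
  then have "nat (- k) = Suc (nat (- (k + 1)))" "nat (k + 1) = 0" "nat k = 0" by auto
  then show ?thesis by (simp add: int_scale_def)
qed

lemma int_scale_uminus: "int_scale (- k) g = - int_scale k g"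
  by (simp add: int_scale_def)

lemma int_scale_add: "int_scale (j + k) g = int_scale j g + int_scale k g"
proof (induction k rule: int_induct[where k = 0])
  case (step1 k)
  then show ?case using int_scale_add_1[of "j + k" g] int_scale_add_1[of k g]
    by (simp add: algebra_simps)
next
  case (step2 k)
  then show ?case using int_scale_add_1[of "j + (k - 1)" g] int_scale_add_1[of "k - 1" g]
    by (simp add: algebra_simps)
qed simp

lemma int_scale_sum: "int_scale k (\<Sum>g\<in>A. f g) = (\<Sum>g\<in>A. int_scale k (f g))"
  unfolding int_scale_def sum_subtractf by (subst (1 2) sum.swap) simp

text \<open>Translation by \<open>g\<close> permutes the group, so adding \<open>g\<close> to every
  element leaves the total unchanged, and cancelling it kills \<open>|G|\<close> copies of
  \<open>g\<close>.\<close>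

lemma int_scale_card_UNIV: "int_scale (int CARD('g)) (g :: 'g::{finite,ab_group_add}) = 0"
proof -
  have "(\<Sum>x\<in>UNIV. x) = (\<Sum>x\<in>UNIV. x + g)"
    by (rule sum.reindex_bij_betw[symmetric]) (auto intro: bij_betwI[where g = "\<lambda>x. x - g"])
  also have "\<dots> = (\<Sum>x\<in>UNIV. x) + (\<Sum>x\<in>(UNIV::'g set). g)" by (rule sum.distrib)
  finally have "(\<Sum>x\<in>(UNIV::'g set). g) = 0" by simp
  moreover have "(\<Sum>x\<in>A. g) = int_scale (int (card A)) g" if "finite A" for A :: "'g set"
    using that by (induction A rule: finite_induct)
      (auto simp: int_scale_add_1 add.commute[of 1] add.commute[of g])
  ultimately show ?thesis by simp
qed

lemma int_scale_card_UNIV_mult: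
  "int_scale (int CARD('g) * k) (g :: 'g::{finite,ab_group_add}) = 0"
proof (induction k rule: int_induct[where k = 0])
  case (step1 k)
  then show ?case by (simp add: distrib_left int_scale_add int_scale_card_UNIV)
next
  case (step2 k)
  then show ?case
    using int_scale_add[of "int CARD('g) * (k - 1)" "int CARD('g)" g]
    by (simp add: right_diff_distrib int_scale_card_UNIV)
qed simp

lemma sum_mset_eq_sum_int_scale:
  "\<Sum>\<^sub># S = (\<Sum>x\<in>UNIV. int_scale (int (count S x)) (x :: 'g::{finite,ab_group_add}))"
proof (induction S)
  case (add y S)
  have "(\<Sum>x\<in>UNIV. int_scale (int (count (add_mset y S) x)) x)
      = (\<Sum>x\<in>UNIV. int_scale (int (count S x)) x + (if x = y then x else 0))"
    by (rule sum.cong) (auto simp: int_scale_add_1 add.commute[of 1])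
  then show ?case using add by (simp add: sum.distrib add.commute)
qed simp

lemma size_eq_sum_count: "size (S :: 'g::finite multiset) = (\<Sum>x\<in>UNIV. count S x)"
  unfolding size_multiset_overloaded_eq
  by (rule sum.mono_neutral_left) (auto simp: not_in_iff)

subsection \<open>Sequences and multiplicities on orbits\<close>

text \<open>The group-valued linear form whose integer kernel is
  \<open>orbit_lattice\<close>.\<close>

definition orbit_sum :: "('g::{finite,ab_group_add} \<Rightarrow> 'g) \<Rightarrow> ('g set \<Rightarrow> int) \<Rightarrow> 'g" where
  "orbit_sum a c = (\<Sum>A\<in>orbits a. int_scale (c A) (\<Sum>g\<in>A. g))"

lemma card_orbit_pos:
  fixes a :: "'g::finite \<Rightarrow> 'g"
  shows "A \<in> orbits a \<Longrightarrow> 0 < card A"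
  using orbit_nonempty[of a] by (auto simp: orbits_def card_gt_0_iff)

locale finite_group_bijection =
  fixes a :: "'g::{finite,ab_group_add} \<Rightarrow> 'g"
  assumes bij: "bij a"
begin

lemma permutation: "permutation a"
  using bij by (simp add: permutation)

lemma self_in_orbit: "x \<in> orbit a x"
  by (rule permutation_self_in_orbit[OF permutation])

lemma orbit_in_orbits: "orbit a x \<in> orbits a"
  by (simp add: orbits_def)

lemma orbit_eq: "A \<in> orbits a \<Longrightarrow> x \<in> A \<Longrightarrow> orbit a x = A"
  using cyclic_on_orbit'[OF permutation] by (auto simp: orbits_def cyclic_on_alldef)

lemma sum_over_orbits: "(\<Sum>x\<in>UNIV. f x) = (\<Sum>A\<in>orbits a. \<Sum>x\<in>A. f x)"
proof -
  have "\<Union> (orbits a) = UNIV"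
    using self_in_orbit orbit_in_orbits by blast
  moreover have "\<forall>A\<in>orbits a. \<forall>B\<in>orbits a. A \<noteq> B \<longrightarrow> A \<inter> B = {}"
    using orbit_eq by blast
  ultimately show ?thesis
    using sum.Union_disjoint[of "orbits a" f] by simp
qed

text \<open>An orbit has at most \<open>|G|\<close> elements, so its length divides
  \<open>|G|!\<close>. The extra factor \<open>|G|\<close> makes each period a multiple of
  \<open>|G|\<close>, and such multiples annihilate the group.\<close>

sublocale ws: weighted_system "orbits a" "\<lambda>A. int (card A)" "\<lambda>c. orbit_sum a c = 0"
  "int CARD('g) * fact CARD('g)"
proof
  show "finite (orbits a)" by simp
  show "orbits a \<noteq> {}" by (simp add: orbits_def)
  show "0 < int CARD('g) * (fact CARD('g) :: int)" by (simp add: zero_less_card_finite)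
  show "\<And>A. A \<in> orbits a \<Longrightarrow> 0 < int (card A)" by (simp add: card_orbit_pos)
  have dvd: "int (card A) dvd fact CARD('g)" if "A \<in> orbits a" for A
  proof -
    have "card A dvd fact CARD('g)"
      using card_orbit_pos[OF that] by (intro dvd_fact) (auto intro: card_mono)
    then have "int (card A) dvd int (fact CARD('g))" by presburger
    then show ?thesis by simp
  qed
  then show "\<And>A. A \<in> orbits a \<Longrightarrow> int (card A) dvd int CARD('g) * fact CARD('g)" by simp
  show "(orbit_sum a (\<lambda>A. c A + int CARD('g) * fact CARD('g) div int (card A) * q A) = 0)
      = (orbit_sum a c = 0)" for c q
  proof -
    have "int_scale (int CARD('g) * fact CARD('g) div int (card A) * q A) g = 0"
      if "A \<in> orbits a" for A and g :: 'g
    proof -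
      have "int CARD('g) * fact CARD('g) div int (card A) * q A
          = int CARD('g) * (fact CARD('g) div int (card A) * q A)"
        using dvd[OF that] by (simp only: div_mult_swap[symmetric] mult.assoc)
      then show ?thesis by (simp only: int_scale_card_UNIV_mult)
    qed
    then show ?thesis by (simp add: orbit_sum_def int_scale_add cong: sum.cong)
  qed
  show "(orbit_sum a (\<lambda>A. - c A) = 0) = (orbit_sum a c = 0)" for c
    by (simp add: orbit_sum_def int_scale_uminus sum_negf)
qed

lemma
  assumes "\<And>x. int (count S x) = c (orbit a x)"
  shows size_eq_weight: "int (size S) = ws.weight c"
    and sum_mset_eq_orbit_sum: "\<Sum>\<^sub># S = orbit_sum a c"
proof -
  have count: "int (count S x) = c A" if "A \<in> orbits a" "x \<in> A" for x A
    using assms[of x] orbit_eq[OF that] by simp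
  have "int (size S) = (\<Sum>A\<in>orbits a. \<Sum>x\<in>A. int (count S x))"
    by (simp add: size_eq_sum_count sum_over_orbits)
  also have "\<dots> = ws.weight c"
    unfolding ws.weight_def by (rule sum.cong) (simp_all add: count cong: sum.cong)
  finally show "int (size S) = ws.weight c" .
  have "\<Sum>\<^sub># S = (\<Sum>A\<in>orbits a. \<Sum>x\<in>A. int_scale (int (count S x)) x)"
    by (simp add: sum_mset_eq_sum_int_scale sum_over_orbits)
  also have "\<dots> = orbit_sum a c"
    unfolding orbit_sum_def by (rule sum.cong) (simp_all add: count int_scale_sum cong: sum.cong)
  finally show "\<Sum>\<^sub># S = orbit_sum a c" .
qed

text \<open>Injectivity makes \<open>x\<close> the only preimage of \<open>a x\<close>, so the image
  carries the multiplicity of \<open>x\<close> to \<open>a x\<close>; surjectivity reaches every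
  element.\<close>

lemma image_mset_eq_iff: "image_mset a S = S \<longleftrightarrow> (\<forall>x. count S (a x) = count S x)"
proof -
  have "a -` {a x} = {x}" for x
    using inj_vimage_image_eq[OF bij_is_inj[OF bij], of "{x}"] by simp
  then have count: "count (image_mset a S) (a x) = count S x" for x
    by (cases "x \<in># S") (simp_all add: count_image_mset not_in_iff)
  show ?thesis
  proof
    assume "image_mset a S = S"
    then show "\<forall>x. count S (a x) = count S x" using count by metis
  next
    assume *: "\<forall>x. count S (a x) = count S x"
    show "image_mset a S = S"
    proof (rule multiset_eqI)
      fix y
      obtain x where "y = a x" using bij by (meson bij_pointE)
      then show "count (image_mset a S) y = count S y" using count * by simp
    qed
  qed
qed

lemma count_orbit:
  assumes "image_mset a S = S" "y \<in> orbit a x"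
  shows "count S y = count S x"
  using assms(2) by induction (use assms(1) in \<open>auto simp: image_mset_eq_iff\<close>)

text \<open>A fixed sequence has constant multiplicity on each orbit, so one integer per orbit
  determines it. With \<open>0 \<le> s\<close> the entries are nonnegative and \<open>nat\<close>
  loses nothing; full support is \<open>s = 1\<close>.\<close>

lemma card_fixed_zerosum_seqs_bounded_below:
  assumes "0 \<le> s"
  shows "card {S \<in> fixed_zerosum_seqs a m. \<forall>x. s \<le> int (count S x)} = card (ws.solutions s (int m))"
proof -
  define f where "f c = Abs_multiset (\<lambda>x. nat (c (orbit a x)))" for c :: "'g set \<Rightarrow> int"
  \<comment> \<open>Any representative of the orbit would give the same value, by
    \<open>count_orbit\<close>.\<close>
  define g where "g S A = (if A \<in> orbits a then int (count S (SOME x. x \<in> A)) else 0)"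
    for S :: "'g multiset" and A
  have count_f: "int (count (f c) x) = c (orbit a x)" if "c \<in> ws.solutions s (int m)" for c x
    using that assms orbit_in_orbits[of x] unfolding f_def
    by (subst count_Abs_multiset) (auto simp: ws.solutions_def)
  have some: "(SOME x. x \<in> A) \<in> A" if "A \<in> orbits a" for A
    using card_orbit_pos[OF that] by (auto simp: some_in_eq)
  have g_orbit: "int (count S x) = g S (orbit a x)" if "image_mset a S = S" for S x
    using count_orbit[OF that some[OF orbit_in_orbits]] orbit_in_orbits by (simp add: g_def)
  have "bij_betw g {S \<in> fixed_zerosum_seqs a m. \<forall>x. s \<le> int (count S x)}
          (ws.solutions s (int m))"
  proof (rule bij_betw_byWitness[where f' = f])
    show "\<forall>S\<in>{S \<in> fixed_zerosum_seqs a m. \<forall>x. s \<le> int (count S x)}. f (g S) = S"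
    proof
      fix S assume "S \<in> {S \<in> fixed_zerosum_seqs a m. \<forall>x. s \<le> int (count S x)}"
      then have "image_mset a S = S" by (simp add: fixed_zerosum_seqs_def)
      then show "f (g S) = S"
        by (simp add: f_def count_inverse flip: g_orbit)
    qed
    show "\<forall>c\<in>ws.solutions s (int m). g (f c) = c"
    proof (intro ballI ext)
      fix c A assume c: "c \<in> ws.solutions s (int m)"
      show "g (f c) A = c A"
      proof (cases "A \<in> orbits a")
        case True
        then show ?thesis using count_f[OF c] orbit_eq[OF True some[OF True]] by (simp add: g_def)
      next
        case False
        then show ?thesis using c by (simp add: g_def ws.solutions_def vanishing_off_def)
      qed
    qed
    show "g ` {S \<in> fixed_zerosum_seqs a m. \<forall>x. s \<le> int (count S x)} \<subseteq> ws.solutions s (int m)"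
    proof safe
      fix S assume S: "S \<in> fixed_zerosum_seqs a m" "\<forall>x. s \<le> int (count S x)"
      then have "image_mset a S = S" by (simp add: fixed_zerosum_seqs_def)
      note * = g_orbit[OF this]
      have "g S \<in> vanishing_off (orbits a)" "\<forall>A\<in>orbits a. s \<le> g S A"
        using S(2) by (simp_all add: vanishing_off_def g_def)
      then show "g S \<in> ws.solutions s (int m)"
        using S(1) size_eq_weight[OF *] sum_mset_eq_orbit_sum[OF *]
        by (auto simp: ws.solutions_def fixed_zerosum_seqs_def zerosum_seqs_def)
    qed
    show "f ` ws.solutions s (int m) \<subseteq> {S \<in> fixed_zerosum_seqs a m. \<forall>x. s \<le> int (count S x)}"
    proof (rule image_subsetI)
      fix c assume c: "c \<in> ws.solutions s (int m)"
      note * = count_f[OF c]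
      have "orbit a (a x) = orbit a x" for x
        by (rule permutation_orbit_step[OF permutation])
      then have "int (count (f c) (a x)) = int (count (f c) x)" for x
        by (simp only: *)
      then have "count (f c) (a x) = count (f c) x" for x
        by (simp only: of_nat_eq_iff)
      then show "f c \<in> {S \<in> fixed_zerosum_seqs a m. \<forall>x. s \<le> int (count S x)}"
        using c size_eq_weight[OF *] sum_mset_eq_orbit_sum[OF *] * orbit_in_orbits
        by (auto simp: ws.solutions_def fixed_zerosum_seqs_def zerosum_seqs_def image_mset_eq_iff)
    qed
  qed
  then show ?thesis by (rule bij_betw_same_card)
qed

lemma card_full_fixed_zerosum_seqs:
  "card (full_fixed_zerosum_seqs a m) = card (ws.solutions 1 (int m))"
proof -
  have "set_mset S = UNIV \<longleftrightarrow> (\<forall>x. 1 \<le> int (count S x))" for S :: "'g multiset"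
    by (auto simp: set_eq_iff Suc_le_eq)
  then show ?thesis
    using card_fixed_zerosum_seqs_bounded_below[of 1 m] by (simp add: full_fixed_zerosum_seqs_def)
qed

subsection \<open>Lattice points of the orbit simplex\<close>

text \<open>These are the vertices of the simplex; they show that it is nonempty and serve as test
  points for its relative interior.\<close>

lemma vertex_in_orbit_simplex:
  assumes "B \<in> orbits a"
  shows "(\<chi> A. if A = B then 1 / real (card B) else 0) \<in> orbit_simplex a"
proof -
  have "(\<Sum>A\<in>orbits a. real (card A) * (if A = B then 1 / real (card B) else 0))
      = (\<Sum>A\<in>orbits a. if A = B then 1 else 0)"
    using card_orbit_pos[OF assms] by (intro sum.cong) auto
  then show ?thesis
    using assms by (auto simp: orbit_simplex_def orbit_space_def)
qed

lemma orbit_simplex_nonempty: "orbit_simplex a \<noteq> {}"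
  using vertex_in_orbit_simplex[OF orbit_in_orbits] by blast

lemma convex_orbit_simplex: "convex (orbit_simplex a)"
proof (rule convexI)
  fix x y u v assume "x \<in> orbit_simplex a" "y \<in> orbit_simplex a" "0 \<le> u" "0 \<le> v" "u + v = (1::real)"
  moreover have "(\<Sum>A\<in>orbits a. real (card A) * (u * x $ A + v * y $ A))
      = u * (\<Sum>A\<in>orbits a. real (card A) * x $ A) + v * (\<Sum>A\<in>orbits a. real (card A) * y $ A)"
    by (simp add: sum_distrib_left algebra_simps sum.distrib)
  ultimately show "u *\<^sub>R x + v *\<^sub>R y \<in> orbit_simplex a"
    by (simp add: orbit_simplex_def orbit_space_def)
qed

text \<open>A point is in the relative interior iff every segment from a point of the convex set to
  it can be prolonged slightly beyond it.\<close>

lemma rel_interior_orbit_simplex: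
  "rel_interior (orbit_simplex a) = {z \<in> orbit_simplex a. \<forall>A\<in>orbits a. 0 < z $ A}"
proof (intro set_eqI iffI)
  fix z assume z: "z \<in> rel_interior (orbit_simplex a)"
  have in_simplex: "z \<in> orbit_simplex a" using z rel_interior_subset by blast
  have "z $ B \<noteq> 0" if B: "B \<in> orbits a" for B
  proof
    assume "z $ B = 0"
    \<comment> \<open>Prolonging the segment from the vertex of \<open>B\<close> beyond
      \<open>z\<close> would make coordinate \<open>B\<close> equal to
      \<open>(1 - e) / card B\<close>, which is negative.\<close>
    let ?v = "\<chi> A. if A = B then 1 / real (card B) else 0"
    obtain e where e: "e > 1" "(1 - e) *\<^sub>R ?v + e *\<^sub>R z \<in> orbit_simplex a"
      using z vertex_in_orbit_simplex[OF B]
      unfolding convex_rel_interior_iff[OF convex_orbit_simplex orbit_simplex_nonempty] by blast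
    then have "0 \<le> ((1 - e) *\<^sub>R ?v + e *\<^sub>R z) $ B"
      using B unfolding orbit_simplex_def by blast
    then have "0 \<le> (1 - e) / real (card B)" using \<open>z $ B = 0\<close> by simp
    then show False using e card_orbit_pos[OF B] by (simp add: zero_le_divide_iff)
  qed
  then show "z \<in> {z \<in> orbit_simplex a. \<forall>A\<in>orbits a. 0 < z $ A}"
    using in_simplex by (auto simp: orbit_simplex_def less_le)
next
  fix z assume z: "z \<in> {z \<in> orbit_simplex a. \<forall>A\<in>orbits a. 0 < z $ A}"
  show "z \<in> rel_interior (orbit_simplex a)"
    unfolding convex_rel_interior_iff[OF convex_orbit_simplex orbit_simplex_nonempty]
  proof
    \<comment> \<open>The prolonged point is \<open>z + t * (z - x)\<close>. Its coordinates are
      positive at \<open>t = 0\<close>, hence nonnegative for small \<open>t > 0\<close>, uniformly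
      over the finitely many orbits.\<close>
    fix x assume x: "x \<in> orbit_simplex a"
    have "\<forall>\<^sub>F t in at_right 0. 0 \<le> z $ A + t * (z $ A - x $ A)" if "A \<in> orbits a" for A
    proof -
      have "((\<lambda>t. z $ A + t * (z $ A - x $ A)) \<longlongrightarrow> z $ A + 0 * (z $ A - x $ A)) (at_right 0)"
        by (intro tendsto_intros)
      then have "\<forall>\<^sub>F t in at_right 0. 0 < z $ A + t * (z $ A - x $ A)"
        using z that by (intro order_tendstoD) auto
      then show ?thesis by (rule eventually_mono) simp
    qed
    then have "\<forall>\<^sub>F t in at_right 0. \<forall>A\<in>orbits a. 0 \<le> z $ A + t * (z $ A - x $ A)"
      by (simp add: eventually_ball_finite_distrib)
    then have "\<forall>\<^sub>F t in at_right (0::real). 0 < t \<and> (\<forall>A\<in>orbits a. 0 \<le> z $ A + t * (z $ A - x $ A))"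
      using eventually_at_right_less by (rule eventually_elim2) blast
    then obtain t where t: "0 < t" "\<forall>A\<in>orbits a. 0 \<le> z $ A + t * (z $ A - x $ A)"
      using eventually_happens'[OF trivial_limit_at_right_real] by blast
    have "(\<Sum>A\<in>orbits a. real (card A) * ((1 + t) * z $ A - t * x $ A))
      = (1 + t) * (\<Sum>A\<in>orbits a. real (card A) * z $ A) - t * (\<Sum>A\<in>orbits a. real (card A) * x $ A)"
      by (simp add: sum_distrib_left algebra_simps sum.distrib sum_subtractf)
    then have "(1 - (1 + t)) *\<^sub>R x + (1 + t) *\<^sub>R z \<in> orbit_simplex a"
      using t x z by (auto simp: orbit_simplex_def orbit_space_def algebra_simps)
    then show "\<exists>e>1. (1 - e) *\<^sub>R x + e *\<^sub>R z \<in> orbit_simplex a"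
      using t(1) by (intro exI[of _ "1 + t"]) simp
  qed
qed

text \<open>Rescaling by \<open>1 / m\<close> works for \<open>m > 0\<close>. For
  \<open>m = 0\<close> positive orbit lengths force every coordinate on the right to vanish, and
  both sides are \<open>{0}\<close>.\<close>

lemma dilate_orbit_simplex:
  "(\<lambda>x. real m *\<^sub>R x) ` orbit_simplex a = {x \<in> orbit_space a.
     (\<forall>A\<in>orbits a. 0 \<le> x $ A) \<and> (\<Sum>A\<in>orbits a. real (card A) * x $ A) = real m}" (is "?L = ?R")
proof (cases "m = 0")
  case True
  have "?R = {0}"
  proof (intro set_eqI iffI)
    fix x assume x: "x \<in> ?R"
    then have "\<forall>A\<in>orbits a. real (card A) * x $ A = 0"
      using True by (subst sum_nonneg_eq_0_iff[symmetric]) auto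
    then have "x $ A = 0" for A
      using x card_orbit_pos[of A a] by (cases "A \<in> orbits a") (auto simp: orbit_space_def)
    then show "x \<in> {0}" by (simp add: vec_eq_iff)
  qed (use True in \<open>auto simp: orbit_space_def\<close>)
  moreover have "?L = {0}" using True orbit_simplex_nonempty by auto
  ultimately show ?thesis by simp
next
  case False
  have sum: "(\<Sum>A\<in>orbits a. real (card A) * (t * x $ A)) = t * (\<Sum>A\<in>orbits a. real (card A) * x $ A)"
    for t and x :: "real ^ 'g set"
    by (simp add: sum_distrib_left mult_ac)
  show ?thesis
  proof (intro set_eqI iffI)
    fix x assume "x \<in> ?R"
    then have "(1 / real m) *\<^sub>R x \<in> orbit_simplex a"
      using False sum[of "1 / real m" x] by (simp add: orbit_simplex_def orbit_space_def)
    moreover have "x = real m *\<^sub>R (1 / real m) *\<^sub>R x" using False by simp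
    ultimately show "x \<in> ?L" by blast
  qed (auto simp: orbit_simplex_def orbit_space_def sum)
qed

lemma dilate_rel_interior_orbit_simplex:
  assumes "m > 0"
  shows "(\<lambda>x. real m *\<^sub>R x) ` rel_interior (orbit_simplex a)
    = {x \<in> (\<lambda>x. real m *\<^sub>R x) ` orbit_simplex a. \<forall>A\<in>orbits a. 0 < x $ A}"
  unfolding rel_interior_orbit_simplex using assms by (auto simp: zero_less_mult_iff)

section \<open>Integer vectors as points of the orbit lattice\<close>

definition real_vector :: "('g set \<Rightarrow> int) \<Rightarrow> real ^ 'g set" where
  "real_vector c = (\<chi> A. real_of_int (c A))"

lemma inj_real_vector: "inj real_vector"
  by (auto simp: inj_def real_vector_def vec_eq_iff)

lemma orbit_lattice_eq:
  "orbit_lattice a = real_vector ` {c \<in> vanishing_off (orbits a). orbit_sum a c = 0}"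
proof (intro set_eqI iffI)
  fix x assume "x \<in> orbit_lattice a"
  then obtain c where c: "orbit_sum a c = 0"
    "x = (\<chi> A. if A \<in> orbits a then real_of_int (c A) else 0)"
    by (auto simp: orbit_lattice_def orbit_sum_def)
  let ?c = "\<lambda>A. if A \<in> orbits a then c A else 0"
  have "x = real_vector ?c" by (simp add: c(2) real_vector_def vec_eq_iff)
  moreover have "orbit_sum a ?c = 0" using c(1) by (simp add: orbit_sum_def cong: sum.cong)
  ultimately show "x \<in> real_vector ` {c \<in> vanishing_off (orbits a). orbit_sum a c = 0}"
    by (auto simp: vanishing_off_def)
next
  fix x assume "x \<in> real_vector ` {c \<in> vanishing_off (orbits a). orbit_sum a c = 0}"
  then obtain c where c: "c \<in> vanishing_off (orbits a)" "orbit_sum a c = 0" "x = real_vector c"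
    by blast
  have "x = (\<chi> A. if A \<in> orbits a then real_of_int (c A) else 0)"
    using c by (simp add: real_vector_def vec_eq_iff vanishing_off_def)
  then show "x \<in> orbit_lattice a"
    using c(2) unfolding orbit_lattice_def orbit_sum_def by blast
qed

lemma real_vector_in_dilate_iff:
  assumes "c \<in> vanishing_off (orbits a)"
  shows "real_vector c \<in> (\<lambda>x. real m *\<^sub>R x) ` orbit_simplex a
    \<longleftrightarrow> (\<forall>A\<in>orbits a. 0 \<le> c A) \<and> ws.weight c = int m"
proof -
  have "(\<Sum>A\<in>orbits a. real (card A) * real_of_int (c A)) = real_of_int (ws.weight c)"
    by (simp add: ws.weight_def)
  moreover have "real_of_int (ws.weight c) = real m \<longleftrightarrow> ws.weight c = int m" by linarith
  ultimately show ?thesis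
    unfolding dilate_orbit_simplex using assms
    by (simp add: real_vector_def orbit_space_def vanishing_off_def)
qed

lemma dilate_Int_orbit_lattice:
  "(\<lambda>x. real m *\<^sub>R x) ` orbit_simplex a \<inter> orbit_lattice a = real_vector ` ws.solutions 0 (int m)"
proof -
  have Int_image: "X \<inter> real_vector ` C = real_vector ` {c \<in> C. real_vector c \<in> X}" for X C
    by auto
  show ?thesis
    unfolding orbit_lattice_eq Int_image ws.solutions_def
    by (simp add: real_vector_in_dilate_iff conj_ac cong: conj_cong)
qed

lemma dilate_rel_interior_Int_orbit_lattice:
  assumes "m > 0"
  shows "(\<lambda>x. real m *\<^sub>R x) ` rel_interior (orbit_simplex a) \<inter> orbit_lattice a
    = real_vector ` ws.solutions 1 (int m)"
proof -
  have "(\<lambda>x. real m *\<^sub>R x) ` rel_interior (orbit_simplex a) \<inter> orbit_lattice a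
      = {x \<in> real_vector ` ws.solutions 0 (int m). \<forall>A\<in>orbits a. 0 < x $ A}"
    unfolding dilate_rel_interior_orbit_simplex[OF assms] dilate_Int_orbit_lattice[symmetric] by blast
  also have "\<dots> = real_vector ` {c \<in> ws.solutions 0 (int m). \<forall>A\<in>orbits a. 0 < c A}"
    by (auto simp: real_vector_def)
  \<comment> \<open>For integers, strict positivity is the lower bound 1.\<close>
  also have "{c \<in> ws.solutions 0 (int m). \<forall>A\<in>orbits a. 0 < c A} = ws.solutions 1 (int m)"
    by (force simp: ws.solutions_def)
  finally show ?thesis .
qed

section \<open>Transport of the counts to the polytope and its Ehrhart quasipolynomial\<close>

lemma dilate_count_image:
  assumes "lattice_iso a T" "X \<subseteq> orbit_space a"
  shows "dilate_count (T ` X) m = card ((\<lambda>x. real m *\<^sub>R x) ` X \<inter> orbit_lattice a)"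
proof -
  have T: "linear T" "inj_on T (orbit_space a)" "T ` orbit_lattice a = int_points"
    using assms(1) by (auto simp: lattice_iso_def bij_betw_def)
  have sub: "(\<lambda>x. real m *\<^sub>R x) ` X \<subseteq> orbit_space a" "orbit_lattice a \<subseteq> orbit_space a"
    using assms(2) by (auto simp: orbit_space_def orbit_lattice_def)
  have "(\<lambda>x. real m *\<^sub>R x) ` T ` X = T ` (\<lambda>x. real m *\<^sub>R x) ` X"
    by (simp add: image_image linear_scale[OF T(1)])
  \<comment> \<open>Injectivity of \<open>T\<close> on the orbit space lets the image commute with
    the intersection, and \<open>int_points\<close> is the image of the lattice.\<close>
  then have "dilate_count (T ` X) m = card (T ` ((\<lambda>x. real m *\<^sub>R x) ` X \<inter> orbit_lattice a))"
    unfolding dilate_count_def using inj_on_image_Int[OF T(2) sub] T(3) by simp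
  also have "\<dots> = card ((\<lambda>x. real m *\<^sub>R x) ` X \<inter> orbit_lattice a)"
    using T(2) sub by (intro card_image) (blast intro: inj_on_subset)
  finally show ?thesis .
qed

lemma orbit_simplex_subset: "orbit_simplex a \<subseteq> orbit_space a"
  by (auto simp: orbit_simplex_def)

lemma dilate_count_orbit_polytope:
  assumes "lattice_iso a T"
  shows "dilate_count (orbit_polytope a T) m = card (ws.solutions 0 (int m))"
  unfolding orbit_polytope_def dilate_count_image[OF assms orbit_simplex_subset]
    dilate_Int_orbit_lattice
  by (intro card_image inj_on_subset[OF inj_real_vector]) simp

text \<open>A linear map carries the relative interior of a convex set onto that of its image, which
  reduces the count to the simplex.\<close>

lemma dilate_count_rel_interior_orbit_polytope:
  assumes "lattice_iso a T" "m > 0"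
  shows "dilate_count (rel_interior (orbit_polytope a T)) m = card (ws.solutions 1 (int m))"
proof -
  have "linear T" using assms(1) by (simp add: lattice_iso_def)
  then have "rel_interior (orbit_polytope a T) = T ` rel_interior (orbit_simplex a)"
    unfolding orbit_polytope_def
    by (rule rel_interior_convex_linear_image[OF _ convex_orbit_simplex, symmetric])
  moreover have "rel_interior (orbit_simplex a) \<subseteq> orbit_space a"
    using rel_interior_subset orbit_simplex_subset by blast
  ultimately show ?thesis
    by (simp add: dilate_count_image[OF assms(1)] dilate_rel_interior_Int_orbit_lattice[OF assms(2)]
        card_image[OF inj_on_subset[OF inj_real_vector]])
qed

lemma ehrhart_orbit_polytope:
  assumes "lattice_iso a T"
  shows "ehrhart (orbit_polytope a T) = ws.hilbert"
  by (rule ehrhart_eqI[OF ws.quasipolynomial_hilbert])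
     (simp add: dilate_count_orbit_polytope[OF assms] ws.card_solutions_0)

lemma ehrhart_orbit_polytope_reciprocity:
  assumes "lattice_iso a T" "m > 0"
  shows "ehrhart (orbit_polytope a T) (- int m)
    = (-1) ^ (orbit_count a - 1) * real (card (ws.solutions 1 (int m)))"
  using ws.card_solutions_1[of "int m"] assms(2)
  by (simp add: ehrhart_orbit_polytope[OF assms(1)] orbit_count_def)

end

theorem theorem3p2:
  fixes a :: "'g::{finite,ab_group_add} \<Rightarrow> 'g"
    and T :: "real ^ 'g set \<Rightarrow> real ^ 'n::finite"
    and m :: nat
  assumes "bij a" and "\<And>x y. a (x + y) = a x + a y"
    and "CARD('n) = orbit_count a"
    and "lattice_iso a T"
    and "m > 0"
  shows "fixed_zerosum_count a T (- int m) =
           (-1) ^ (orbit_count a - 1) * real (card (full_fixed_zerosum_seqs a m))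
       \<and> ehrhart (orbit_polytope a T) (- int m) =
           (-1) ^ (orbit_count a - 1) * real (dilate_count (rel_interior (orbit_polytope a T)) m)"
proof -
  interpret finite_group_bijection a by unfold_locales fact
  \<comment> \<open>As \<open>- int m\<close> is negative, \<open>fixed_zerosum_count\<close> is the
    Ehrhart value, and both right-hand sides count \<open>ws.solutions 1 (int m)\<close>.\<close>
  show ?thesis
    using assms(5)
    by (simp add: fixed_zerosum_count_def card_full_fixed_zerosum_seqs
        ehrhart_orbit_polytope_reciprocity[OF assms(4,5)]
        dilate_count_rel_interior_orbit_polytope[OF assms(4,5)])
qed

end
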